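(* For $x,\theta\in[0,1]$ and $m\in\mathbb{N}$ let $K(x;\theta,m)=m$ if both $x$ and $\theta$ belong to $\big(\frac{i-1}{m},\frac im\big)$ for some $1\le i\le m$, and $K(x;\theta,m)=0$ otherwise. Let $\Pi$ be a prior on $\mathscr{M}([0,1]\times\mathbb{N})$ and let $\Pi^*$ be the kernel mixture prior induced by $\Pi$ via $P\mapsto f_P$, $f_P(x)=\int K(x;\theta,m)\,dP(\theta,m)$. If $f_0$ is a continuous density on $[0,1]$ and the weak support of $\Pi$ contains $\mathscr{M}([0,1]\times\mathbb{N})$, then $f_0\in\mathrm{KL}(\Pi^* )$.
   Context: $\mathbb{N}$ is the set of positive integers; $\mathscr{M}(S)$ is the set of probability measures on $S$; a prior is a probability measure on the indicated space; the weak support of a prior on $\mathscr{M}(S)$ is its support in the topology of weak convergence. $f_0\in\mathrm{KL}(\Pi^* )$ means $\Pi^*(\{f:\int f_0\log(f_0/f)<\epsilon\})>0$ for every $\epsilon>0$. *)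

theory Defs
  imports "HOL-Probability.Probability"
begin

text \<open>Measures on a set \<open>S\<close> live on the trace Borel \<open>\<sigma>\<close>-algebra. The space of probability measures
  carries the \<open>\<sigma>\<close>-algebra generated by the evaluations \<open>P \<mapsto> P A\<close>; for \<open>S\<close> separable metrizable this
  is the Borel \<open>\<sigma>\<close>-algebra of the topology of weak convergence.\<close>

abbreviation prob_measures_on :: "'a::topological_space set \<Rightarrow> 'a measure measure" where
  "prob_measures_on S \<equiv> prob_algebra (restrict_space borel S)"

definition weak_topology_on :: "'a::topological_space set \<Rightarrow> 'a measure topology" where
  "weak_topology_on S = topology_generated_by
     {{P \<in> space (prob_measures_on S). (\<integral>s. g s \<partial>P) \<in> V} | (g :: 'a \<Rightarrow> real) V.
        continuous_on S g \<and> bounded (g ` S) \<and> open V}"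

definition prior_on :: "'a::topological_space set \<Rightarrow> 'a measure measure \<Rightarrow> bool" where
  "prior_on S \<pi> \<longleftrightarrow> prob_space \<pi> \<and> sets \<pi> = sets (prob_measures_on S)"

definition weak_support :: "'a::topological_space set \<Rightarrow> 'a measure measure \<Rightarrow> 'a measure set" where
  "weak_support S \<pi> = {P \<in> topspace (weak_topology_on S).
     \<forall>U. openin (weak_topology_on S) U \<and> P \<in> U \<longrightarrow> 0 < emeasure \<pi> U}"

definition hist_params :: "(real \<times> nat) set" where
  "hist_params = {0..1} \<times> {1..}"

definition hist_kernel :: "real \<Rightarrow> real \<times> nat \<Rightarrow> real" where
  "hist_kernel x = (\<lambda>(\<theta>, m).
     if \<exists>i\<in>{1..m}. x \<in> {(real i - 1) / real m <..< real i / real m} \<and>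
                   \<theta> \<in> {(real i - 1) / real m <..< real i / real m}
     then real m else 0)"

text \<open>For \<open>hist_kernel\<close> the integral below can diverge (and then is \<open>0\<close> by convention), but only for
  \<open>x\<close> in a Lebesgue null set, by Tonelli.\<close>

definition mixture :: "(real \<Rightarrow> 's \<Rightarrow> real) \<Rightarrow> 's measure \<Rightarrow> real \<Rightarrow> real" where
  "mixture K P x = (\<integral>s. K x s \<partial>P)"

text \<open>Since \<open>hist_kernel x (\<theta>, m)\<close> vanishes for all \<open>x\<close> when \<open>\<theta>\<close> is a grid point \<open>i/m\<close>, a mixture can
  have total mass below one. Hence the induced prior has to live on subprobability densities.\<close>

definition subdensities :: "(real \<Rightarrow> real) set" where
  "subdensities = {f \<in> borel_measurable (restrict_space borel {0..1}).
     (\<forall>x\<in>{0..1}. 0 \<le> f x) \<and> (\<integral>\<^sup>+x\<in>{0..1}. ennreal (f x) \<partial>lborel) \<le> 1}"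

text \<open>The push-forward is taken on the largest \<open>\<sigma>\<close>-algebra for which \<open>P \<mapsto> f\<^sub>P\<close> is measurable.\<close>

definition mixture_prior ::
  "(real \<Rightarrow> 's \<Rightarrow> real) \<Rightarrow> 's measure measure \<Rightarrow> (real \<Rightarrow> real) measure" where
  "mixture_prior K \<pi> = distr \<pi>
     (sigma subdensities {A. A \<subseteq> subdensities \<and> mixture K -` A \<inter> space \<pi> \<in> sets \<pi>})
     (mixture K)"

text \<open>The value of \<open>\<integral> f\<^sub>0 log (f\<^sub>0 / f)\<close> over \<open>[0,1]\<close> is extended real, with \<open>0 log (0/q) = 0\<close> and
  \<open>p log (p/0) = \<infinity>\<close> for \<open>p > 0\<close>. The negative part is at most \<open>\<integral> f\<close>, so the difference is never
  \<open>\<infinity> - \<infinity>\<close> for \<open>f\<close> in \<open>subdensities\<close>.\<close>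

definition KL_integrand :: "real \<Rightarrow> real \<Rightarrow> ereal" where
  "KL_integrand p q = (if p = 0 then 0 else if q = 0 then \<infinity> else ereal (p * ln (p / q)))"

definition KL_div :: "(real \<Rightarrow> real) \<Rightarrow> (real \<Rightarrow> real) \<Rightarrow> ereal" where
  "KL_div f0 f =
     enn2ereal (\<integral>\<^sup>+x\<in>{0..1}. e2ennreal (KL_integrand (f0 x) (f x)) \<partial>lborel) -
     enn2ereal (\<integral>\<^sup>+x\<in>{0..1}. e2ennreal (- KL_integrand (f0 x) (f x)) \<partial>lborel)"

definition KL :: "(real \<Rightarrow> real) measure \<Rightarrow> (real \<Rightarrow> real) set" where
  "KL \<pi>' = {f0. \<forall>\<epsilon>>0. 0 < emeasure \<pi>' {f \<in> space \<pi>'. KL_div f0 f < ereal \<epsilon>}}"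

end

theory Submission
  imports Defs
begin

text \<open>If \<open>f\<^sub>0 \<le> C f\<^sub>P\<close> almost everywhere on the unit interval, where \<open>C \<ge> 1\<close>, then the
  divergence of \<open>f\<^sub>P\<close> from \<open>f\<^sub>0\<close> is at most \<open>ln C\<close>, because \<open>f\<^sub>0\<close> has mass one (\<open>KL_div_le_ln\<close>). So it suffices to find, for \<open>\<eta> > 0\<close>, a
  nonempty weakly open set of mixing measures \<open>P\<close> with \<open>f\<^sub>0 \<le> (1 + \<eta>)\<^sup>2 f\<^sub>P\<close> almost everywhere. A
  one-sided bound of this kind is insensitive to zeros of \<open>f\<^sub>0\<close>, and it survives weak perturbation:
  the mass that \<open>P\<close> gives to an open set can only jump up in the limit, not down.

  By uniform continuity some \<open>m\<close> makes \<open>f\<^sub>0\<close> oscillate by at most \<open>\<eta>\<close> on every cell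
  \<open>((i - 1)/m, i/m)\<close>. Give cell \<open>i\<close> the mass of \<open>f\<^sub>0 + \<eta>\<close> over that cell, divided by \<open>1 + \<eta>\<close>. These
  weights \<open>p i\<close> sum to one and satisfy \<open>f\<^sub>0 \<le> (1 + \<eta>) m p i\<close> on cell \<open>i\<close> (\<open>hist_weights\<close>). Let \<open>P\<^sub>0\<close>
  put mass \<open>p i\<close> at the midpoint of cell \<open>i\<close>, with second coordinate \<open>m\<close>. The kernel is
  discontinuous in \<open>\<theta>\<close>, but on cell \<open>i\<close> it dominates \<open>m\<close> times a continuous tent function that is
  one at the midpoint. Hence the conditions \<open>\<integral> tent m i dP > p i / (1 + \<eta>)\<close> for \<open>i = 1, \<dots>, m\<close> define
  a weak neighbourhood of \<open>P\<^sub>0\<close> on which the required lower bound for \<open>f\<^sub>P\<close> holds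
  (\<open>weak_neighbourhood_KL\<close>).

  Since \<open>emeasure\<close> is zero off the \<open>\<sigma>\<close>-algebra, positivity also rests on the divergence being a
  measurable function of \<open>P\<close>, and on every \<open>f\<^sub>P\<close> being a subdensity
  (\<open>emeasure_mixture_prior_KL\<close>). The former follows from joint measurability of
  \<open>(P, x) \<mapsto> f\<^sub>P x\<close>, the latter from Tonelli's theorem.\<close>

section \<open>The histogram kernel\<close>

abbreviation hist_cell :: "nat \<Rightarrow> nat \<Rightarrow> real set" where
  "hist_cell m i \<equiv> {(real i - 1) / real m <..< real i / real m}"

lemma hist_kernel_nonneg: "0 \<le> hist_kernel x s"
  by (auto simp: hist_kernel_def split: prod.split)

lemma hist_cell_unique:
  assumes "\<theta> \<in> hist_cell m i" "\<theta> \<in> hist_cell m j"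
  shows "i = j"
proof (cases "m = 0")
  case False
  then have "real i - 1 < real j" "real j - 1 < real i"
    using assms by (auto simp: field_simps)
  then show ?thesis by linarith
qed (use assms in auto)

lemma AE_in_hist_cell:
  assumes "m > 0"
  shows "AE x in lborel. x \<in> {0..1} \<longrightarrow> (\<exists>i\<in>{1..m}. x \<in> hist_cell m i)"
proof -
  have "AE x in lborel. x \<notin> (\<lambda>i. real i / real m) ` {0..m}"
    by (intro AE_not_in countable_imp_null_set_lborel) auto
  then show ?thesis
  proof eventually_elim
    case (elim x)
    show ?case
    proof
      assume x: "x \<in> {0..1}"
      define i where "i = nat \<lceil>x * real m\<rceil>"
      have "real i / real m \<noteq> x" if "i \<le> m" for i
        using elim that by auto
      then have ne: "real i \<noteq> x * real m" if "i \<le> m" for i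
        using that assms by (force simp: field_simps)
      have pos: "0 < x * real m"
      proof -
        have "0 \<le> x * real m" using x by simp
        then show ?thesis using ne[OF le0, unfolded of_nat_0] by (rule le_neq_trans)
      qed
      have "x * real m \<le> 1 * real m"
        using x by (intro mult_right_mono) auto
      then have "x * real m \<le> real m" by simp
      then have "\<lceil>x * real m\<rceil> \<le> int m" by (simp add: ceiling_le_iff)
      moreover have ri: "real i = real_of_int \<lceil>x * real m\<rceil>"
        using pos unfolding i_def by simp
      ultimately have "i \<le> m" by linarith
      moreover have "i \<ge> 1" using ri pos by linarith
      moreover have "x * real m < real i"
        using ne[OF \<open>i \<le> m\<close>] ri by linarith
      moreover have "real i - 1 < x * real m" using ri by linarith
      ultimately show "\<exists>i\<in>{1..m}. x \<in> hist_cell m i"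
        using assms by (intro bexI[of _ i]) (auto simp: field_simps)
    qed
  qed
qed

text \<open>The index range \<open>{1..m}\<close> depends on the argument; replacing it by a quantifier over all naturals,
  guarded by inequalities between Borel functions, exhibits a countable union of Borel sets.\<close>

lemma measurable_hist_kernel:
  "case_prod hist_kernel \<in> borel_measurable (borel \<Otimes>\<^sub>M restrict_space borel S)"
proof -
  have eq: "case_prod hist_kernel = (\<lambda>(x, s). if \<exists>i::nat. 1 \<le> real i \<and> real i \<le> real (snd s) \<and>
      (real i - 1) / real (snd s) < x \<and> x < real i / real (snd s) \<and>
      (real i - 1) / real (snd s) < fst s \<and> fst s < real i / real (snd s)
      then real (snd s) else 0)"
    by (fastforce simp: hist_kernel_def fun_eq_iff)
  have "fst \<in> borel_measurable (borel :: (real \<times> nat) measure)"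
    by (intro borel_measurable_continuous_onI continuous_intros)
  then have [measurable]: "fst \<in> borel_measurable (restrict_space (borel :: (real \<times> nat) measure) S)"
    by (rule measurable_restrict_space1)
  have "(\<lambda>s. real (snd s)) \<in> borel_measurable (borel :: (real \<times> nat) measure)"
    by (intro borel_measurable_continuous_onI continuous_intros)
  then have [measurable]:
    "(\<lambda>s. real (snd s)) \<in> borel_measurable (restrict_space (borel :: (real \<times> nat) measure) S)"
    by (rule measurable_restrict_space1)
  show ?thesis unfolding eq by measurable
qed

text \<open>As a function of \<open>x\<close> the kernel is the uniform density on the cell containing \<open>\<theta>\<close>; it is the zero
  function when \<open>\<theta>\<close> is a grid point, hence only an inequality.\<close>

lemma nn_integral_hist_kernel_le_1:
  assumes "s \<in> hist_params"
  shows "(\<integral>\<^sup>+x. ennreal (hist_kernel x s) \<partial>lborel) \<le> 1"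
proof -
  obtain \<theta> m where s: "s = (\<theta>, m)" "m \<ge> 1"
    using assms by (cases s) (auto simp: hist_params_def)
  show ?thesis
  proof (cases "\<exists>i\<in>{1..m}. \<theta> \<in> hist_cell m i")
    case True
    then obtain i where i: "\<theta> \<in> hist_cell m i" by blast
    have "ennreal (hist_kernel x s) \<le> ennreal (real m) * indicator (hist_cell m i) x" for x
      using hist_cell_unique[OF i]
      by (auto simp: hist_kernel_def s indicator_def simp del: greaterThanLessThan_iff)
    then have "(\<integral>\<^sup>+x. ennreal (hist_kernel x s) \<partial>lborel)
        \<le> (\<integral>\<^sup>+x. ennreal (real m) * indicator (hist_cell m i) x \<partial>lborel)"
      by (intro nn_integral_mono)
    also have "\<dots> = ennreal (real m) * ennreal (1 / real m)"
      using s by (subst nn_integral_cmult_indicator) (auto simp: divide_right_mono diff_divide_distrib)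
    also have "\<dots> = 1"
      using s by (simp flip: ennreal_mult)
    finally show ?thesis .
  next
    case False
    then have "hist_kernel x s = 0" for x by (auto simp: hist_kernel_def s)
    then show ?thesis by simp
  qed
qed

section \<open>Mixtures\<close>

text \<open>The conventions agree where the integral diverges: the Bochner integral of a nonnegative measurable
  function that is not integrable is \<open>0\<close>, and so is \<open>enn2real \<infinity>\<close>. So measurability in \<open>P\<close> can be
  obtained from nonnegative integrals.\<close>

lemma mixture_hist_kernel_eq:
  assumes "P \<in> space (prob_measures_on S)"
  shows "mixture hist_kernel P x = enn2real (\<integral>\<^sup>+s. ennreal (hist_kernel x s) \<partial>P)"
proof -
  have "sets P = sets (restrict_space borel S)"
    using assms by (simp add: space_prob_algebra)
  then have "hist_kernel x \<in> borel_measurable P"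
    using measurable_Pair2[OF measurable_hist_kernel, of x S] by (simp cong: measurable_cong_sets)
  then show ?thesis
    unfolding mixture_def by (intro integral_eq_nn_integral) (auto simp: hist_kernel_nonneg)
qed

lemma measurable_nn_integral_hist_kernel:
  "(\<lambda>(P, x). \<integral>\<^sup>+s. ennreal (hist_kernel x s) \<partial>P)
     \<in> borel_measurable (prob_measures_on S \<Otimes>\<^sub>M borel)"
proof -
  have [measurable]: "(\<lambda>w. ennreal (hist_kernel (snd (fst w)) (snd w)))
    \<in> borel_measurable ((prob_measures_on S \<Otimes>\<^sub>M borel) \<Otimes>\<^sub>M restrict_space borel S)"
    using measurable_compose[OF _ measurable_hist_kernel[of S],
      of "\<lambda>w. (snd (fst w), snd w)" "(prob_measures_on S \<Otimes>\<^sub>M borel) \<Otimes>\<^sub>M restrict_space borel S"]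
    by simp
  have "(\<lambda>w. \<integral>\<^sup>+s. ennreal (hist_kernel (snd w) s) \<partial>(fst w))
     \<in> borel_measurable (prob_measures_on S \<Otimes>\<^sub>M borel)"
    by (rule nn_integral_measurable_subprob_algebra2[where N = "restrict_space borel S"])
       (auto simp: split_beta' intro!: measurable_prob_algebraD)
  then show ?thesis by (simp add: split_beta')
qed

lemma measurable_mixture_hist_kernel:
  "(\<lambda>(P, x). mixture hist_kernel P x) \<in> borel_measurable (prob_measures_on S \<Otimes>\<^sub>M borel)"
proof -
  have "(\<lambda>w. enn2real (case w of (P, x) \<Rightarrow> \<integral>\<^sup>+s. ennreal (hist_kernel x s) \<partial>P))
     \<in> borel_measurable (prob_measures_on S \<Otimes>\<^sub>M borel)"
    using measurable_nn_integral_hist_kernel[of S] by measurable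
  then show ?thesis
    by (rule measurable_cong[THEN iffD1, rotated])
       (auto simp: space_pair_measure mixture_hist_kernel_eq)
qed

lemma nn_integral_hist_mixture_le_1:
  assumes P: "P \<in> space (prob_measures_on hist_params)"
  shows "(\<integral>\<^sup>+x. \<integral>\<^sup>+s. ennreal (hist_kernel x s) \<partial>P \<partial>lborel) \<le> 1"
proof -
  have sets[measurable_cong]: "sets P = sets (restrict_space borel hist_params)"
    and ps: "prob_space P"
    using P by (auto simp: space_prob_algebra)
  have sp: "space P = hist_params"
    using sets_eq_imp_space_eq[OF sets] by (simp add: space_restrict_space)
  interpret prob_space P by fact
  interpret pair_sigma_finite lborel P ..
  have "(\<lambda>z. ennreal (case_prod hist_kernel z)) \<in> borel_measurable (lborel \<Otimes>\<^sub>M P)"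
    using measurable_hist_kernel[of hist_params]
    by (simp cong: measurable_cong_sets add: sets_pair_measure_cong[OF sets_lborel sets])
  then have "(\<integral>\<^sup>+x. \<integral>\<^sup>+s. ennreal (hist_kernel x s) \<partial>P \<partial>lborel)
      = (\<integral>\<^sup>+s. \<integral>\<^sup>+x. ennreal (hist_kernel x s) \<partial>lborel \<partial>P)"
    using Fubini'[of "\<lambda>x s. ennreal (hist_kernel x s)"] by (simp add: split_beta')
  also have "\<dots> \<le> (\<integral>\<^sup>+s. 1 \<partial>P)"
    by (intro nn_integral_mono nn_integral_hist_kernel_le_1) (simp add: sp)
  also have "\<dots> = 1" by (simp add: emeasure_space_1)
  finally show ?thesis .
qed

text \<open>Lower bounds on \<open>mixture hist_kernel P x\<close> may fail where the integral diverges, since there the mixture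
  is \<open>0\<close>. The exceptional set is null.\<close>

lemma AE_nn_integral_hist_kernel_finite:
  assumes P: "P \<in> space (prob_measures_on hist_params)"
  shows "AE x in lborel. (\<integral>\<^sup>+s. ennreal (hist_kernel x s) \<partial>P) \<noteq> \<infinity>"
proof (rule nn_integral_PInf_AE)
  show "(\<lambda>x. \<integral>\<^sup>+s. ennreal (hist_kernel x s) \<partial>P) \<in> borel_measurable lborel"
    using measurable_Pair2[OF measurable_nn_integral_hist_kernel P] by simp
  show "(\<integral>\<^sup>+x. \<integral>\<^sup>+s. ennreal (hist_kernel x s) \<partial>P \<partial>lborel) \<noteq> \<infinity>"
    using nn_integral_hist_mixture_le_1[OF P] by (auto simp: top_unique)
qed

lemma mixture_hist_kernel_in_subdensities:
  assumes P: "P \<in> space (prob_measures_on hist_params)"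
  shows "mixture hist_kernel P \<in> subdensities"
proof -
  have "mixture hist_kernel P \<in> borel_measurable borel"
    using measurable_Pair2[OF measurable_mixture_hist_kernel P] by simp
  then have "mixture hist_kernel P \<in> borel_measurable (restrict_space borel {0..1})"
    by (rule measurable_restrict_space1)
  moreover have "(\<integral>\<^sup>+x\<in>{0..1}. ennreal (mixture hist_kernel P x) \<partial>lborel)
      \<le> (\<integral>\<^sup>+x. \<integral>\<^sup>+s. ennreal (hist_kernel x s) \<partial>P \<partial>lborel)"
    by (intro nn_integral_mono)
       (auto simp: mixture_hist_kernel_eq[OF P] indicator_def ennreal_enn2real_if)
  ultimately show ?thesis
    using order_trans[OF _ nn_integral_hist_mixture_le_1[OF P]]
    by (auto simp: subdensities_def mixture_hist_kernel_eq[OF P])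
qed

section \<open>The Kullback--Leibler divergence\<close>

text \<open>Non-integrable functions have integral \<open>0\<close> by convention.\<close>

lemma set_integrable_if_integral_nonzero:
  fixes f :: "'a \<Rightarrow> real"
  assumes "(LINT x:A|M. f x) \<noteq> 0"
  shows "set_integrable M A f"
  using assms not_integrable_integral_eq unfolding set_lebesgue_integral_def set_integrable_def
  by blast

text \<open>Where \<open>f\<^sub>0 > 0\<close> the domination forces \<open>f > 0\<close> and \<open>ln (f\<^sub>0 / f) \<le> ln C\<close>. With \<open>C \<ge> 1\<close> this also
  bounds the positive part of the integrand by \<open>f\<^sub>0 ln C\<close>; the negative part only decreases the
  divergence.\<close>

lemma KL_div_le_ln:
  assumes C: "1 \<le> C"
    and nonneg: "\<And>x. x \<in> {0..1} \<Longrightarrow> 0 \<le> f\<^sub>0 x"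
    and int: "(LINT x:{0..1}|lborel. f\<^sub>0 x) = 1"
    and dom: "AE x in lborel. x \<in> {0..1} \<longrightarrow> f\<^sub>0 x \<le> C * f x"
  shows "KL_div f\<^sub>0 f \<le> ereal (ln C)"
proof -
  have pointwise: "KL_integrand p q \<le> ereal (p * ln C)" if "0 \<le> p" "p \<le> C * q" for p q
  proof (cases "p = 0")
    case False
    then have "0 < C * q" using that by linarith
    then have "0 < q" using C by (simp add: zero_less_mult_iff)
    then have "ln (p / q) \<le> ln C"
      using that False C by (intro ln_mono) (auto simp: field_simps)
    then show ?thesis
      using that \<open>0 < q\<close> False by (auto simp: KL_integrand_def mult_left_mono)
  qed (simp add: KL_integrand_def)
  have integrable: "set_integrable lborel {0..1} f\<^sub>0"
    using int by (intro set_integrable_if_integral_nonzero) simp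
  have "(\<integral>\<^sup>+x\<in>{0..1}. e2ennreal (KL_integrand (f\<^sub>0 x) (f x)) \<partial>lborel)
      \<le> (\<integral>\<^sup>+x. ennreal (ln C * (indicator {0..1} x *\<^sub>R f\<^sub>0 x)) \<partial>lborel)"
  proof (rule nn_integral_mono_AE, use dom in eventually_elim)
    case (elim x)
    show ?case
    proof (cases "x \<in> {0..1}")
      case True
      then have "KL_integrand (f\<^sub>0 x) (f x) \<le> ereal (f\<^sub>0 x * ln C)"
        using pointwise elim nonneg by blast
      then have "e2ennreal (KL_integrand (f\<^sub>0 x) (f x)) \<le> e2ennreal (ereal (f\<^sub>0 x * ln C))"
        by (rule e2ennreal_mono)
      then show ?thesis using True by (simp add: e2ennreal_ereal mult.commute)
    qed simp
  qed
  also have "\<dots> = ennreal (\<integral>x. ln C * (indicator {0..1} x *\<^sub>R f\<^sub>0 x) \<partial>lborel)"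
    using integrable C nonneg unfolding set_integrable_def
    by (intro nn_integral_eq_integral) (auto simp: indicator_def)
  also have "\<dots> = ennreal (ln C)"
    using int unfolding set_lebesgue_integral_def by (subst integral_mult_right_zero) simp
  finally have "enn2ereal (\<integral>\<^sup>+x\<in>{0..1}. e2ennreal (KL_integrand (f\<^sub>0 x) (f x)) \<partial>lborel) \<le> ereal (ln C)"
    using C by (simp add: less_eq_ennreal.rep_eq enn2ereal_ennreal)
  moreover have "a - enn2ereal b \<le> a" for a b
    using ereal_minus_mono[of a a 0 "enn2ereal b"] by simp
  ultimately show ?thesis
    unfolding KL_div_def by (blast intro: order_trans)
qed

lemma measurable_KL_div_mixture:
  assumes cont: "continuous_on {0..1} f\<^sub>0"
  shows "(\<lambda>P. KL_div f\<^sub>0 (mixture hist_kernel P)) \<in> borel_measurable (prob_measures_on S)"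
proof -
  \<comment> \<open>Only the restriction of \<open>f\<^sub>0\<close> to the unit interval is known to be measurable.\<close>
  define g where "g x = indicator {0..1} x *\<^sub>R f\<^sub>0 x" for x
  have [measurable]: "g \<in> borel_measurable borel"
    using borel_measurable_continuous_on_indicator[OF _ cont] unfolding g_def by simp
  define F where "F w = mixture hist_kernel (fst w) (snd w)" for w
  have [measurable]: "F \<in> borel_measurable (prob_measures_on S \<Otimes>\<^sub>M borel)"
    using measurable_mixture_hist_kernel[of S] by (simp add: F_def[abs_def] split_beta')
  have [measurable]: "(\<lambda>w. KL_integrand (g (snd w)) (F w))
      \<in> borel_measurable (prob_measures_on S \<Otimes>\<^sub>M borel)"
    unfolding KL_integrand_def by measurable
  have meas: "(\<lambda>P. \<integral>\<^sup>+x\<in>{0..1}. h (KL_integrand (f\<^sub>0 x) (mixture hist_kernel P x)) \<partial>lborel)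
      \<in> borel_measurable (prob_measures_on S)" if [measurable]: "h \<in> borel_measurable borel"
    for h :: "ereal \<Rightarrow> ennreal"
  proof -
    have "(\<lambda>P. \<integral>\<^sup>+x. h (KL_integrand (g (snd (P, x))) (F (P, x))) * indicator {0..1} x \<partial>lborel)
      \<in> borel_measurable (prob_measures_on S)"
      by measurable
    also have "(\<lambda>P. \<integral>\<^sup>+x. h (KL_integrand (g (snd (P, x))) (F (P, x))) * indicator {0..1} x \<partial>lborel)
      = (\<lambda>P. \<integral>\<^sup>+x\<in>{0..1}. h (KL_integrand (f\<^sub>0 x) (mixture hist_kernel P x)) \<partial>lborel)"
      by (auto simp: fun_eq_iff g_def F_def indicator_def intro!: nn_integral_cong)
    finally show ?thesis .
  qed
  have [measurable]: "(\<lambda>x::ereal. e2ennreal (- x)) \<in> borel_measurable borel"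
    by measurable
  show ?thesis
    unfolding KL_div_def
    by (intro borel_measurable_ereal_diff measurable_compose[OF _ measurable_enn2ereal]
      meas[of e2ennreal] meas[of "\<lambda>x. e2ennreal (- x)"]) measurable
qed

text \<open>The push-forward carries the largest \<open>\<sigma>\<close>-algebra of subdensities that makes the mixture map
  measurable, so a set of subdensities is measurable as soon as its preimage is.\<close>

lemma emeasure_mixture_prior_KL:
  assumes prior: "prior_on hist_params \<pi>" and cont: "continuous_on {0..1} f\<^sub>0"
  shows "{P \<in> space \<pi>. KL_div f\<^sub>0 (mixture hist_kernel P) < ereal \<epsilon>} \<in> sets \<pi>"
    and "emeasure (mixture_prior hist_kernel \<pi>)
        {f \<in> space (mixture_prior hist_kernel \<pi>). KL_div f\<^sub>0 f < ereal \<epsilon>}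
      = emeasure \<pi> {P \<in> space \<pi>. KL_div f\<^sub>0 (mixture hist_kernel P) < ereal \<epsilon>}"
proof -
  have sets[measurable_cong]: "sets \<pi> = sets (prob_measures_on hist_params)"
    using prior by (simp add: prior_on_def)
  note sp = sets_eq_imp_space_eq[OF sets]
  note [measurable] = measurable_KL_div_mixture[OF cont, of hist_params]
  show pre: "{P \<in> space \<pi>. KL_div f\<^sub>0 (mixture hist_kernel P) < ereal \<epsilon>} \<in> sets \<pi>"
    by measurable
  define G where "G = {A. A \<subseteq> subdensities \<and> mixture hist_kernel -` A \<inter> space \<pi> \<in> sets \<pi>}"
  let ?A = "{f \<in> subdensities. KL_div f\<^sub>0 f < ereal \<epsilon>}"
  have space: "space (sigma subdensities G) = subdensities"
    by (auto simp: G_def intro!: space_measure_of)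
  have meas: "mixture hist_kernel \<in> measurable \<pi> (sigma subdensities G)"
    by (rule measurable_measure_of)
       (auto simp: G_def sp mixture_hist_kernel_in_subdensities)
  have vim: "mixture hist_kernel -` ?A \<inter> space \<pi>
      = {P \<in> space \<pi>. KL_div f\<^sub>0 (mixture hist_kernel P) < ereal \<epsilon>}"
    by (auto simp: sp mixture_hist_kernel_in_subdensities)
  have "?A \<in> G" using pre vim by (auto simp: G_def)
  moreover have "G \<subseteq> Pow subdensities" by (auto simp: G_def)
  ultimately have "?A \<in> sets (sigma subdensities G)" by auto
  then show "emeasure (mixture_prior hist_kernel \<pi>)
        {f \<in> space (mixture_prior hist_kernel \<pi>). KL_div f\<^sub>0 f < ereal \<epsilon>}
      = emeasure \<pi> {P \<in> space \<pi>. KL_div f\<^sub>0 (mixture hist_kernel P) < ereal \<epsilon>}"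
    unfolding mixture_prior_def G_def[symmetric] space_distr space
    by (simp only: emeasure_distr[OF meas] vim)
qed

section \<open>Weak neighbourhoods\<close>

lemma topspace_weak_topology_on: "topspace (weak_topology_on S) = space (prob_measures_on S)"
proof -
  have "space (prob_measures_on S) \<in> {{P \<in> space (prob_measures_on S). (\<integral>s. g s \<partial>P) \<in> V} |
        (g :: 'a \<Rightarrow> real) V. continuous_on S g \<and> bounded (g ` S) \<and> open V}"
    by (intro CollectI exI[of _ "\<lambda>_. 0"] exI[of _ UNIV]) (auto simp: image_constant_conv)
  then show ?thesis
    unfolding weak_topology_on_def topology_generated_by_topspace by blast
qed

text \<open>A finite intersection of subbasic sets, one half-line \<open>{r i<..}\<close> for each test function.\<close>

lemma openin_weak_topology_on_integral_greater:
  fixes g :: "'i \<Rightarrow> 'a::topological_space \<Rightarrow> real"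
  assumes "finite I"
    and "\<And>i. i \<in> I \<Longrightarrow> continuous_on S (g i)" "\<And>i. i \<in> I \<Longrightarrow> bounded (g i ` S)"
  shows "openin (weak_topology_on S) {P \<in> space (prob_measures_on S). \<forall>i\<in>I. r i < (\<integral>s. g i s \<partial>P)}"
  using assms
proof (induction I rule: finite_induct)
  case empty
  then show ?case
    using openin_topspace[of "weak_topology_on S"] by (simp add: topspace_weak_topology_on)
next
  case (insert j I)
  have "openin (weak_topology_on S) {P \<in> space (prob_measures_on S). (\<integral>s. g j s \<partial>P) \<in> {r j<..}}"
    unfolding weak_topology_on_def using insert.prems
    by (intro topology_generated_by_Basis CollectI exI[of _ "g j"] exI[of _ "{r j<..}"]) auto
  from openin_Int[OF this insert.IH] insert.prems show ?case
    by (auto elim!: back_subst[of "openin _"])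
qed

text \<open>The measure is \<open>\<Sum>i\<in>I. p i \<delta>(t i)\<close>, built as the image under \<open>t\<close> of a weighted counting measure on
  the index set; the points \<open>t i\<close> may coincide.\<close>

lemma discrete_prob_measure:
  fixes t :: "'i \<Rightarrow> 'a::topological_space" and p :: "'i \<Rightarrow> real"
  assumes "finite I" and p: "\<And>i. i \<in> I \<Longrightarrow> 0 \<le> p i" "(\<Sum>i\<in>I. p i) = 1"
    and t: "\<And>i. i \<in> I \<Longrightarrow> t i \<in> S"
  obtains P where "P \<in> space (prob_measures_on S)"
    and "\<And>g :: 'a \<Rightarrow> real. continuous_on S g \<Longrightarrow> (\<integral>s. g s \<partial>P) = (\<Sum>i\<in>I. p i * g (t i))"
proof
  let ?Q = "point_measure I (\<lambda>i. ennreal (p i))"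
  let ?P = "distr ?Q (restrict_space borel S) t"
  have meas: "t \<in> measurable ?Q (restrict_space borel S)"
    using t by (auto simp: measurable_point_measure_eq1 space_restrict_space)
  have "prob_space ?Q"
    using assms by (intro prob_spaceI) (simp add: space_point_measure emeasure_point_measure_finite sum_ennreal)
  then show "?P \<in> space (prob_measures_on S)"
    using meas by (simp add: space_prob_algebra prob_space.prob_space_distr)
  show "(\<integral>s. g s \<partial>?P) = (\<Sum>i\<in>I. p i * g (t i))" if "continuous_on S g" for g :: "'a \<Rightarrow> real"
  proof -
    have "(\<integral>s. g s \<partial>?P) = (\<integral>i. g (t i) \<partial>?Q)"
      using that by (intro integral_distr meas borel_measurable_continuous_on_restrict)
    also have "\<dots> = (\<Sum>i\<in>I. p i * g (t i))"
      using assms(1) p by (simp add: lebesgue_integral_point_measure_finite)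
    finally show ?thesis .
  qed
qed

section \<open>Tent functions on the cells\<close>

text \<open>The factor in \<open>fst s\<close> is positive exactly on the open cell and equals one at its midpoint
  \<open>(2 i - 1) / (2 m)\<close>. The indicator of \<open>snd s = m\<close> is continuous because the second coordinate is
  discrete.\<close>

definition tent :: "nat \<Rightarrow> nat \<Rightarrow> real \<times> nat \<Rightarrow> real" where
  "tent m i s = max 0 (1 - \<bar>2 * real m * fst s - (2 * real i - 1)\<bar>) * of_bool (snd s = m)"

lemma continuous_on_tent: "continuous_on A (tent m i)"
  unfolding tent_def[abs_def]
  by (intro continuous_intros
      continuous_on_compose2[OF Topological_Spaces.continuous_on_discrete[of UNIV "\<lambda>n. of_bool (n = m)"]]) auto

lemma tent_nonneg: "0 \<le> tent m i s" and tent_le_1: "tent m i s \<le> 1"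
  by (auto simp: tent_def)

lemma bounded_tent: "bounded (tent m i ` A)"
  by (rule boundedI[of _ 1]) (auto simp: tent_nonneg tent_le_1)

text \<open>For \<open>x\<close> in cell \<open>i\<close>, the kernel as a function of the parameter is \<open>m\<close> times the indicator of cell
  \<open>i\<close> on the slice with second coordinate \<open>m\<close>, plus nonnegative values on the other slices; the tent
  lies below that indicator.\<close>

lemma tent_le_hist_kernel:
  assumes "m > 0" "i \<in> {1..m}" "x \<in> hist_cell m i"
  shows "real m * tent m i s \<le> hist_kernel x s"
proof (cases "tent m i s = 0")
  case False
  then have "snd s = m" and "\<bar>2 * real m * fst s - (2 * real i - 1)\<bar> < 1"
    by (auto simp: tent_def max_def split: if_splits)
  then have "fst s \<in> hist_cell m i"
    using assms(1) by (auto simp: field_simps abs_less_iff)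
  then have "hist_kernel x s = real m"
    using assms \<open>snd s = m\<close> by (auto simp: hist_kernel_def split_beta' simp del: greaterThanLessThan_iff)
  then show ?thesis using tent_le_1[of m i s] by (simp add: mult_left_le)
qed (simp add: hist_kernel_nonneg)

lemma tent_integral_le_mixture:
  assumes P: "P \<in> space (prob_measures_on hist_params)" and m: "m > 0"
    and "i \<in> {1..m}" "x \<in> hist_cell m i"
    and fin: "(\<integral>\<^sup>+s. ennreal (hist_kernel x s) \<partial>P) \<noteq> \<infinity>"
  shows "real m * (\<integral>s. tent m i s \<partial>P) \<le> mixture hist_kernel P x"
proof -
  have sets: "sets P = sets (restrict_space borel hist_params)"
    using P by (simp add: space_prob_algebra)
  have "hist_kernel x \<in> borel_measurable P"
    using measurable_Pair2[OF measurable_hist_kernel, of x hist_params] sets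
    by (simp cong: measurable_cong_sets)
  then have int: "integrable P (hist_kernel x)"
    using fin by (intro integrableI_nonneg) (auto simp: hist_kernel_nonneg less_top)
  have le: "real m * tent m i s \<le> hist_kernel x s" for s
    using assms(2-4) by (rule tent_le_hist_kernel)
  have "tent m i \<in> borel_measurable P"
    using borel_measurable_continuous_on_restrict[OF continuous_on_tent] sets
    by (simp cong: measurable_cong_sets)
  then have "integrable P (\<lambda>s. real m * tent m i s)"
    using le by (intro Bochner_Integration.integrable_bound[OF int])
      (auto simp: hist_kernel_nonneg tent_nonneg)
  then have "(\<integral>s. real m * tent m i s \<partial>P) \<le> (\<integral>s. hist_kernel x s \<partial>P)"
    using int le by (rule Bochner_Integration.integral_mono)
  then show ?thesis by (simp add: mixture_def)
qed

section \<open>A weak neighbourhood of small divergence\<close>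

text \<open>Adding \<open>\<eta>\<close> before taking cell masses serves twice: it keeps every weight positive where \<open>f\<^sub>0\<close>
  vanishes, and it absorbs the oscillation of \<open>f\<^sub>0\<close> on a cell. The total mass becomes \<open>1 + \<eta>\<close>, which
  is the factor lost by normalising.\<close>

lemma hist_weights:
  fixes f\<^sub>0 :: "real \<Rightarrow> real"
  assumes cont: "continuous_on {0..1} f\<^sub>0" and nonneg: "\<And>x. x \<in> {0..1} \<Longrightarrow> 0 \<le> f\<^sub>0 x"
    and int: "(LINT x:{0..1}|lborel. f\<^sub>0 x) = 1" and \<eta>: "0 < \<eta>"
  obtains m p where "m > 0" "\<And>i. i \<in> {1..m} \<Longrightarrow> 0 < p i" "(\<Sum>i\<in>{1..m}. p i) = 1"
    "\<And>i x. i \<in> {1..m} \<Longrightarrow> x \<in> hist_cell m i \<Longrightarrow> f\<^sub>0 x \<le> (1 + \<eta>) * (real m * p i)"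
proof -
  have "uniformly_continuous_on {0..1} f\<^sub>0"
    using cont by (simp add: compact_uniformly_continuous)
  then obtain \<delta> where \<delta>: "\<delta> > 0"
    "\<And>x y. x \<in> {0..1} \<Longrightarrow> y \<in> {0..1} \<Longrightarrow> dist y x < \<delta> \<Longrightarrow> dist (f\<^sub>0 y) (f\<^sub>0 x) < \<eta>"
    using \<eta> unfolding uniformly_continuous_on_def by meson
  obtain m where m: "m > 0" "1 / real m < \<delta>"
    using \<delta>(1) by (metis nat_approx_posE zero_less_Suc)
  define I where "I i = {(real i - 1) / real m .. real i / real m}" for i
  have sub: "I i \<subseteq> {0..1}" if "i \<in> {1..m}" for i
    using that m(1) by (auto simp: I_def field_simps intro: order_trans)
  define a where "a i = integral (I i) f\<^sub>0" for i
  define p where "p i = (a i + \<eta> / real m) / (1 + \<eta>)" for i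
  have integrable: "f\<^sub>0 integrable_on {c..d}" if "0 \<le> c" "d \<le> 1" for c d
    using that by (intro integrable_continuous_interval continuous_on_subset[OF cont]) auto
  have a_nonneg: "0 \<le> a i" if "i \<in> {1..m}" for i
    unfolding a_def
  proof (rule integral_nonneg)
    show "f\<^sub>0 integrable_on I i"
      using sub[OF that] unfolding I_def
      by (intro integrable_continuous_interval continuous_on_subset[OF cont])
  qed (use sub[OF that] nonneg in blast)
  have "(\<Sum>i\<in>{1..k}. a i) = integral {0..real k / real m} f\<^sub>0" if "k \<le> m" for k
    using that
  proof (induction k)
    case (Suc k)
    have "(\<Sum>i\<in>{1..Suc k}. a i) = integral {0..real k / real m} f\<^sub>0
        + integral {real k / real m..real (Suc k) / real m} f\<^sub>0"
      using Suc by (simp add: a_def I_def)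
    also have "\<dots> = integral {0..real (Suc k) / real m} f\<^sub>0"
      using Suc.prems m(1) by (intro Henstock_Kurzweil_Integration.integral_combine integrable)
          (auto simp: divide_right_mono)
    finally show ?case .
  qed simp
  from this[of m] m(1) have "(\<Sum>i\<in>{1..m}. a i) = integral {0..1} f\<^sub>0" by simp
  also have "\<dots> = 1"
  proof -
    have "set_integrable lborel {0..1} f\<^sub>0"
      using int by (intro set_integrable_if_integral_nonzero) simp
    from set_borel_integral_eq_integral(2)[OF this] int show ?thesis by simp
  qed
  finally have sum_a: "(\<Sum>i\<in>{1..m}. a i) = 1" .
  have a_lower: "f\<^sub>0 x \<le> real m * a i + \<eta>" if i: "i \<in> {1..m}" and x: "x \<in> hist_cell m i" for i x
  proof -
    have "integral (I i) (\<lambda>_. f\<^sub>0 x - \<eta>) \<le> a i"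
      unfolding a_def
    proof (rule integral_le)
      show "f\<^sub>0 integrable_on I i"
        using sub[OF i] unfolding I_def by (intro integrable_continuous_interval continuous_on_subset[OF cont])
      show "f\<^sub>0 x - \<eta> \<le> f\<^sub>0 y" if y: "y \<in> I i" for y
      proof -
        have "real i / real m = (real i - 1) / real m + 1 / real m"
          by (simp add: diff_divide_distrib)
        then have "dist y x < \<delta>"
          using y x m(2) by (auto simp: I_def dist_real_def)
        moreover have "x \<in> I i" using x by (auto simp: I_def)
        ultimately show ?thesis
          using \<delta>(2)[of x y] sub[OF i] y by (fastforce simp: dist_real_def abs_less_iff)
      qed
    qed (auto simp: I_def intro: integrable_const_ivl)
    moreover have "integral (I i) (\<lambda>_. f\<^sub>0 x - \<eta>) = (f\<^sub>0 x - \<eta>) / real m"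
      using m(1) by (simp add: I_def content_real divide_right_mono field_simps)
    ultimately show ?thesis using m(1) by (simp add: field_simps)
  qed
  show thesis
  proof
    show "m > 0" by fact
    show "0 < p i" if "i \<in> {1..m}" for i
      using a_nonneg[OF that] \<eta> m(1) by (simp add: p_def add_nonneg_pos)
    show "(\<Sum>i\<in>{1..m}. p i) = 1"
      using sum_a \<eta> m(1) by (simp add: p_def sum.distrib flip: sum_divide_distrib)
    show "f\<^sub>0 x \<le> (1 + \<eta>) * (real m * p i)" if "i \<in> {1..m}" "x \<in> hist_cell m i" for i x
    proof -
      have "(1 + \<eta>) * p i = a i + \<eta> / real m"
        using \<eta> by (simp add: p_def)
      then have "real m * ((1 + \<eta>) * p i) = real m * a i + \<eta>"
        using m(1) by (simp add: distrib_left)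
      then show ?thesis using a_lower[OF that] by (simp add: mult.left_commute)
    qed
  qed
qed

text \<open>One factor \<open>1 + \<eta>\<close> comes from the weights and one from the thresholds, which lie
  below the tent integrals \<open>p i\<close> of \<open>P\<^sub>0\<close> so that \<open>P\<^sub>0\<close> meets the open conditions. As \<open>ln (1 + \<eta>) \<le> \<eta>\<close>, the divergence is at most \<open>2 \<eta>\<close>.\<close>

lemma weak_neighbourhood_KL:
  fixes f\<^sub>0 :: "real \<Rightarrow> real"
  assumes cont: "continuous_on {0..1} f\<^sub>0" and nonneg: "\<And>x. x \<in> {0..1} \<Longrightarrow> 0 \<le> f\<^sub>0 x"
    and int: "(LINT x:{0..1}|lborel. f\<^sub>0 x) = 1" and \<epsilon>: "0 < \<epsilon>"
  obtains P\<^sub>0 U where "P\<^sub>0 \<in> U" "openin (weak_topology_on hist_params) U"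
    "\<And>P. P \<in> U \<Longrightarrow> KL_div f\<^sub>0 (mixture hist_kernel P) < ereal \<epsilon>"
proof -
  \<comment> \<open>Any \<open>\<eta>\<close> with \<open>2 \<eta> < \<epsilon>\<close> works.\<close>
  define \<eta> where "\<eta> = \<epsilon> / 3"
  have \<eta>: "0 < \<eta>" using \<epsilon> by (simp add: \<eta>_def)
  obtain m p where m: "m > 0" and p: "\<And>i. i \<in> {1..m} \<Longrightarrow> 0 < p i" "(\<Sum>i\<in>{1..m}. p i) = 1"
    and dom: "\<And>i x. i \<in> {1..m} \<Longrightarrow> x \<in> hist_cell m i \<Longrightarrow> f\<^sub>0 x \<le> (1 + \<eta>) * (real m * p i)"
    using hist_weights[OF cont nonneg int \<eta>] by metis
  define t where "t i = ((2 * real i - 1) / (2 * real m), m)" for i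
  have "t i \<in> hist_params" if "i \<in> {1..m}" for i
    using that m by (auto simp: t_def hist_params_def field_simps)
  then obtain P\<^sub>0 where P0: "P\<^sub>0 \<in> space (prob_measures_on hist_params)"
    and P0_int: "\<And>g :: real \<times> nat \<Rightarrow> real. continuous_on hist_params g \<Longrightarrow>
        (\<integral>s. g s \<partial>P\<^sub>0) = (\<Sum>i\<in>{1..m}. p i * g (t i))"
    using discrete_prob_measure[of "{1..m}" p t hist_params] p by (metis finite_atLeastAtMost less_imp_le)
  define U where "U = {P \<in> space (prob_measures_on hist_params).
      \<forall>i\<in>{1..m}. p i / (1 + \<eta>) < (\<integral>s. tent m i s \<partial>P)}"
  show thesis
  proof
    show "openin (weak_topology_on hist_params) U"
      unfolding U_def
      by (intro openin_weak_topology_on_integral_greater) (auto simp: continuous_on_tent bounded_tent)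
    have "p i / (1 + \<eta>) < (\<integral>s. tent m i s \<partial>P\<^sub>0)" if i: "i \<in> {1..m}" for i
    proof -
      have "p i / (1 + \<eta>) < p i" using p(1)[OF i] \<eta> by (simp add: field_simps)
      also have "p i = p i * tent m i (t i)" using m by (simp add: tent_def t_def)
      also have "\<dots> \<le> (\<Sum>j\<in>{1..m}. p j * tent m i (t j))"
        using i p(1) by (intro member_le_sum) (auto simp: tent_nonneg less_imp_le)
      also have "\<dots> = (\<integral>s. tent m i s \<partial>P\<^sub>0)"
        by (simp add: P0_int continuous_on_tent)
      finally show ?thesis .
    qed
    then show "P\<^sub>0 \<in> U" using P0 by (simp add: U_def)
    fix P assume "P \<in> U"
    then have P: "P \<in> space (prob_measures_on hist_params)"
      and tent: "\<And>i. i \<in> {1..m} \<Longrightarrow> p i / (1 + \<eta>) < (\<integral>s. tent m i s \<partial>P)"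
      by (auto simp: U_def)
    have "AE x in lborel. x \<in> {0..1} \<longrightarrow> f\<^sub>0 x \<le> (1 + \<eta>)\<^sup>2 * mixture hist_kernel P x"
      using AE_in_hist_cell[OF m] AE_nn_integral_hist_kernel_finite[OF P]
    proof eventually_elim
      case (elim x)
      show ?case
      proof
        assume "x \<in> {0..1}"
        then obtain i where i: "i \<in> {1..m}" "x \<in> hist_cell m i" using elim(1) by blast
        have "f\<^sub>0 x \<le> (1 + \<eta>)\<^sup>2 * (real m * (p i / (1 + \<eta>)))"
          using dom[OF i] \<eta> by (simp add: power2_eq_square)
        also have "\<dots> \<le> (1 + \<eta>)\<^sup>2 * (real m * (\<integral>s. tent m i s \<partial>P))"
          using tent[OF i(1)] by (intro mult_left_mono) auto
        also have "\<dots> \<le> (1 + \<eta>)\<^sup>2 * mixture hist_kernel P x"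
          using tent_integral_le_mixture[OF P m i elim(2)] by (intro mult_left_mono) auto
        finally show "f\<^sub>0 x \<le> (1 + \<eta>)\<^sup>2 * mixture hist_kernel P x" .
      qed
    qed
    then have "KL_div f\<^sub>0 (mixture hist_kernel P) \<le> ereal (ln ((1 + \<eta>)\<^sup>2))"
      using \<eta> by (intro KL_div_le_ln nonneg int) auto
    also have "ln ((1 + \<eta>)\<^sup>2) \<le> 2 * \<eta>"
      using \<eta> ln_add_one_self_le_self[of \<eta>] by (simp add: ln_realpow)
    also have "2 * \<eta> < \<epsilon>" using \<epsilon> by (simp add: \<eta>_def)
    finally show "KL_div f\<^sub>0 (mixture hist_kernel P) < ereal \<epsilon>" by simp
  qed
qed

theorem theorem9:
  fixes \<pi> :: "(real \<times> nat) measure measure" and f\<^sub>0 :: "real \<Rightarrow> real"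
  assumes "prior_on hist_params \<pi>"
    and "continuous_on {0..1} f\<^sub>0"
    and "\<forall>x\<in>{0..1}. 0 \<le> f\<^sub>0 x"
    and "(LINT x:{0..1}|lborel. f\<^sub>0 x) = 1"
    and "space (prob_measures_on hist_params) \<subseteq> weak_support hist_params \<pi>"
  shows "f\<^sub>0 \<in> KL (mixture_prior hist_kernel \<pi>)"
proof -
  have sp: "space \<pi> = space (prob_measures_on hist_params)"
    using assms(1) sets_eq_imp_space_eq unfolding prior_on_def by blast
  have nonneg: "0 \<le> f\<^sub>0 x" if "x \<in> {0..1}" for x
    using assms(3) that by blast
  have "0 < emeasure (mixture_prior hist_kernel \<pi>)
      {f \<in> space (mixture_prior hist_kernel \<pi>). KL_div f\<^sub>0 f < ereal \<epsilon>}" if \<epsilon>: "0 < \<epsilon>" for \<epsilon>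
  proof -
    let ?B = "{P \<in> space \<pi>. KL_div f\<^sub>0 (mixture hist_kernel P) < ereal \<epsilon>}"
    obtain P\<^sub>0 U where U: "P\<^sub>0 \<in> U" "openin (weak_topology_on hist_params) U"
      and KL: "\<And>P. P \<in> U \<Longrightarrow> KL_div f\<^sub>0 (mixture hist_kernel P) < ereal \<epsilon>"
      using weak_neighbourhood_KL[OF assms(2) nonneg assms(4) \<epsilon>] by blast
    have "U \<subseteq> space \<pi>"
      using openin_subset[OF U(2)] by (simp add: sp topspace_weak_topology_on)
    then have "P\<^sub>0 \<in> weak_support hist_params \<pi>" and "U \<subseteq> ?B"
      using assms(5) U(1) KL sp by auto
    then have "0 < emeasure \<pi> U"
      using U by (simp add: weak_support_def)
    also have "\<dots> \<le> emeasure \<pi> ?B"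
      using \<open>U \<subseteq> ?B\<close> emeasure_mixture_prior_KL(1)[OF assms(1,2)] by (rule emeasure_mono)
    finally show ?thesis
      by (simp only: emeasure_mixture_prior_KL(2)[OF assms(1,2)])
  qed
  then show ?thesis by (simp add: KL_def)
qed

end
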